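(* Let $\Vert\cdot\Vert:\mathbb{R}^n\to\mathbb{R}$ be a vector norm. Then its dual continuation $\Vert\cdot\Vert:\mathbb{DR}^n\to\mathbb{DR}$ satisfies, for every $\boldsymbol{x}=\boldsymbol{x}_{\rm s}+\boldsymbol{x}_{\rm i}\epsilon\in\mathbb{DR}^n$, $$\Vert\boldsymbol{x}\Vert=\begin{cases}\Vert\boldsymbol{x}_{\rm s}\Vert+\max\limits_{\boldsymbol{y}\in\partial\Vert\boldsymbol{x}_{\rm s}\Vert}\langle\boldsymbol{y},\boldsymbol{x}_{\rm i}\rangle\,\epsilon, & \boldsymbol{x}_{\rm s}\neq\boldsymbol{0},\\ \Vert\boldsymbol{x}_{\rm i}\Vert\,\epsilon, & \boldsymbol{x}_{\rm s}=\boldsymbol{0},\end{cases}$$ and it is a dual-valued vector norm on $\mathbb{DR}^n$.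
   Context: Dual numbers: $\mathbb{DR}=\{p_{\rm s}+p_{\rm i}\epsilon: p_{\rm s},p_{\rm i}\in\mathbb{R}\}$ with $\epsilon\neq0$, $\epsilon^2=0$ (a commutative ring); $p_{\rm s}$ is the standard part and $p_{\rm i}$ the infinitesimal part. Dual vectors $\boldsymbol{x}\in\mathbb{DR}^n$ are written $\boldsymbol{x}=\boldsymbol{x}_{\rm s}+\boldsymbol{x}_{\rm i}\epsilon$ with $\boldsymbol{x}_{\rm s},\boldsymbol{x}_{\rm i}\in\mathbb{R}^n$. Total order on $\mathbb{DR}$: $p<q$ if $p_{\rm s}<q_{\rm s}$, or $p_{\rm s}=q_{\rm s}$ and $p_{\rm i}<q_{\rm i}$. Absolute value: $|a+b\epsilon|=|a|+\mathrm{sign}(a)b\epsilon$ if $a\ne0$ and $|b\epsilon|=|b|\epsilon$ (the case $a=0$), for $a,b\in\mathbb{R}$. Gâteaux derivative: $\mathcal{D}_u\phi(x)=\lim_{t\downarrow0}\frac{\phi(x+tu)-\phi(x)}{t}$. The dual continuation of a real-valued function $\phi$ on a real space $\mathcal{X}$ is $\tilde\phi(a+b\epsilon)=\phi(a)+\mathcal{D}_b\phi(a)\,\epsilon$ for $a,b\in\mathcal{X}$; the dual continuation of a norm is denoted by the same symbol. $\partial\Vert\boldsymbol{x}_{\rm s}\Vert$ denotes the (convex) subdifferential of the norm at $\boldsymbol{x}_{\rm s}$. A dual-valued vector norm on $\mathbb{DR}^n$ is a function $f:\mathbb{DR}^n\to\mathbb{DR}$ such that, under the total order: (i) $f(\boldsymbol{x})\ge0$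 for all $\boldsymbol{x}$, and $f(\boldsymbol{x})=0$ iff $\boldsymbol{x}=\boldsymbol{0}$; (ii) $f(c\boldsymbol{x})=|c|f(\boldsymbol{x})$ for all $c\in\mathbb{DR}$, $\boldsymbol{x}\in\mathbb{DR}^n$; (iii) $f(\boldsymbol{x}+\boldsymbol{y})\le f(\boldsymbol{x})+f(\boldsymbol{y})$ for all $\boldsymbol{x},\boldsymbol{y}\in\mathbb{DR}^n$. *)

theory Defs
  imports "HOL-Analysis.Analysis"
begin

text \<open>\<open>Dual a b\<close> is the dual number \<open>a + b\<epsilon>\<close>; see \<open>Dual_eq\<close> below.\<close>

datatype dual = Dual (std_part: real) (inf_part: real)

instantiation dual :: comm_ring_1
begin

definition "0 = Dual 0 0"
definition "1 = Dual 1 0"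
definition "p + q = Dual (std_part p + std_part q) (inf_part p + inf_part q)"
definition "p - q = Dual (std_part p - std_part q) (inf_part p - inf_part q)"
definition "- p = Dual (- std_part p) (- inf_part p)"
definition "p * q =
  Dual (std_part p * std_part q) (std_part p * inf_part q + inf_part p * std_part q)"

instance
  by standard
    (auto simp: zero_dual_def one_dual_def plus_dual_def minus_dual_def uminus_dual_def
      times_dual_def algebra_simps intro: dual.expand)

end

instantiation dual :: real_algebra_1
begin

definition "r *\<^sub>R p = Dual (r * std_part p) (r * inf_part p)"

instance
  by standard
    (auto simp: scaleR_dual_def plus_dual_def times_dual_def algebra_simps intro: dual.expand)

end

instantiation dual :: linorder
begin

definition "p < q \<longleftrightarrow>
  std_part p < std_part q \<or> std_part p = std_part q \<and> inf_part p < inf_part q"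
definition "p \<le> q \<longleftrightarrow> p < q \<or> p = (q :: dual)"

instance
  by standard (auto simp: less_dual_def less_eq_dual_def intro: dual.expand)

end

instantiation dual :: abs
begin

definition "\<bar>p\<bar> =
  (if std_part p \<noteq> 0 then Dual \<bar>std_part p\<bar> (sgn (std_part p) * inf_part p)
   else Dual 0 \<bar>inf_part p\<bar>)"

instance ..

end

definition eps :: dual where
  "eps = Dual 0 1"

lemma eps_nonzero: "eps \<noteq> 0"
  by (simp add: eps_def zero_dual_def)

lemma eps_square: "eps ^ 2 = 0"
  by (simp add: eps_def zero_dual_def power2_eq_square times_dual_def)

lemma Dual_eq: "Dual a b = of_real a + of_real b * eps"
  by (simp add: of_real_def eps_def one_dual_def scaleR_dual_def plus_dual_def times_dual_def)

definition std_vec :: "dual ^ 'n \<Rightarrow> real ^ 'n" where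
  "std_vec x = (\<chi> i. std_part (x $ i))"

definition inf_vec :: "dual ^ 'n \<Rightarrow> real ^ 'n" where
  "inf_vec x = (\<chi> i. inf_part (x $ i))"

definition vector_norm :: "(real ^ 'n \<Rightarrow> real) \<Rightarrow> bool" where
  "vector_norm N \<longleftrightarrow>
     (\<forall>x. 0 \<le> N x \<and> (N x = 0 \<longleftrightarrow> x = 0)) \<and>
     (\<forall>c x. N (c *s x) = \<bar>c\<bar> * N x) \<and>
     (\<forall>x y. N (x + y) \<le> N x + N y)"

definition dual_vector_norm :: "(dual ^ 'n \<Rightarrow> dual) \<Rightarrow> bool" where
  "dual_vector_norm f \<longleftrightarrow>
     (\<forall>x. 0 \<le> f x \<and> (f x = 0 \<longleftrightarrow> x = 0)) \<and>
     (\<forall>c x. f (c *s x) = \<bar>c\<bar> * f x) \<and>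
     (\<forall>x y. f (x + y) \<le> f x + f y)"

definition subdifferential :: "('a::real_inner \<Rightarrow> real) \<Rightarrow> 'a \<Rightarrow> 'a set" where
  "subdifferential \<phi> x = {y. \<forall>z. \<phi> x + y \<bullet> (z - x) \<le> \<phi> z}"

definition has_gateaux_derivative ::
    "('a::real_vector \<Rightarrow> real) \<Rightarrow> 'a \<Rightarrow> 'a \<Rightarrow> real \<Rightarrow> bool" where
  "has_gateaux_derivative \<phi> u x D \<longleftrightarrow>
     ((\<lambda>t. (\<phi> (x + t *\<^sub>R u) - \<phi> x) / t) \<longlongrightarrow> D) (at_right 0)"

text \<open>Only meaningful when the limit exists; otherwise an unspecified real.\<close>

definition gateaux_derivative :: "('a::real_vector \<Rightarrow> real) \<Rightarrow> 'a \<Rightarrow> 'a \<Rightarrow> real" where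
  "gateaux_derivative \<phi> u x = (THE D. has_gateaux_derivative \<phi> u x D)"

definition dual_continuation :: "(real ^ 'n \<Rightarrow> real) \<Rightarrow> dual ^ 'n \<Rightarrow> dual" where
  "dual_continuation \<phi> x =
     of_real (\<phi> (std_vec x)) + of_real (gateaux_derivative \<phi> (inf_vec x) (std_vec x)) * eps"

end

theory Submission
  imports Defs
begin

text \<open>
  Everything rests on the one-sided directional derivative \<open>v \<mapsto> D\<^sub>v p(x)\<close> of a sublinear function
  \<open>p\<close>. The difference quotient of \<open>p\<close> is nondecreasing in the step size, by convexity, and is
  bounded below, so it has a limit as the step shrinks to \<open>0\<close>. That limit is again sublinear in
  the direction, is dominated by \<open>p\<close>, and is an odd function along the line spanned by \<open>x\<close>.

  The last property gives a proof of the Hahn--Banach theorem in finite dimension: replacing \<open>p\<close> by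
  its directional derivative at \<open>x\<close> makes it odd along \<open>x\<close> and preserves oddness along every line on
  which \<open>p\<close> is already odd, so differentiating along each vector of a basis in turn ends in a linear
  minorant (lemmas \<open>sublinear_minorant_odd_on\<close> and \<open>linear_minorant_touching\<close>). Applied to
  the directional derivative of a norm at \<open>x\<close>, the theorem provides a subgradient \<open>y\<close> with
  \<open>y \<bullet> u = D\<^sub>u N(x)\<close>. Since \<open>D\<^sub>u N(x)\<close> bounds \<open>y \<bullet> u\<close> for every subgradient \<open>y\<close>, it is the maximum.

  The norm axioms for the dual continuation are read off from its infinitesimal part. The
  triangle inequality holds strictly in the standard part, or else the difference quotients of the
  two sides start from equal values and can be compared termwise. Homogeneity under
  \<open>a + b\<epsilon>\<close> follows from \<open>D\<^sub>u N(0) = N(u)\<close> if \<open>a = 0\<close>, and otherwise combines the scaling \<open>D\<^bsub>a u\<^esub> N(a x) = \<bar>a\<bar> D\<^sub>u N(x)\<close> with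
  \<open>D\<^bsub>u + s x\<^esub> N(x) = D\<^sub>u N(x) + s N(x)\<close>, that is, with the linearity of \<open>N\<close> along the ray
  through \<open>x\<close>.
\<close>

section \<open>Directional derivatives of sublinear functions\<close>

definition sublinear :: "('a::real_vector \<Rightarrow> real) \<Rightarrow> bool" where
  "sublinear p \<longleftrightarrow>
     (\<forall>x y. p (x + y) \<le> p x + p y) \<and> (\<forall>c x. 0 \<le> c \<longrightarrow> p (c *\<^sub>R x) = c * p x)"

lemma sublinear_add: "sublinear p \<Longrightarrow> p (x + y) \<le> p x + p y"
  by (simp add: sublinear_def)

lemma sublinear_scaleR: "sublinear p \<Longrightarrow> 0 \<le> c \<Longrightarrow> p (c *\<^sub>R x) = c * p x"
  by (simp add: sublinear_def)

lemma sublinear_zero: "sublinear p \<Longrightarrow> p 0 = 0"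
  using sublinear_scaleR[of p 0 0] by simp

lemma sublinear_minus: "sublinear p \<Longrightarrow> - p x \<le> p (- x)"
  using sublinear_add[of p x "- x"] sublinear_zero[of p] by simp

lemma gateaux_derivativeI:
  assumes "has_gateaux_derivative \<phi> u x D"
  shows "gateaux_derivative \<phi> u x = D"
  unfolding gateaux_derivative_def
proof (rule the_equality)
  show "has_gateaux_derivative \<phi> u x D" by fact
  show "D' = D" if "has_gateaux_derivative \<phi> u x D'" for D'
    using that assms tendsto_unique[OF trivial_limit_at_right_real]
    unfolding has_gateaux_derivative_def by blast
qed

text \<open>Convexity: \<open>x + s u\<close> lies between \<open>x\<close> and \<open>x + t u\<close>.\<close>

lemma difference_quotient_mono:
  assumes p: "sublinear p" and st: "0 < s" "s \<le> t"
  shows "(p (x + s *\<^sub>R u) - p x) / s \<le> (p (x + t *\<^sub>R u) - p x) / t"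
proof -
  have "x + s *\<^sub>R u = (1 - s / t) *\<^sub>R x + (s / t) *\<^sub>R (x + t *\<^sub>R u)"
    using st by (simp add: algebra_simps)
  then have "p (x + s *\<^sub>R u) \<le> p ((1 - s / t) *\<^sub>R x) + p ((s / t) *\<^sub>R (x + t *\<^sub>R u))"
    by (metis sublinear_add p)
  also have "\<dots> = (1 - s / t) * p x + (s / t) * p (x + t *\<^sub>R u)"
    using st by (simp add: sublinear_scaleR[OF p])
  finally have "p (x + s *\<^sub>R u) - p x \<le> s * ((p (x + t *\<^sub>R u) - p x) / t)"
    by (simp add: algebra_simps diff_divide_distrib)
  then show ?thesis
    using st by (simp add: pos_divide_le_eq mult.commute)
qed

lemma difference_quotient_lower_bound:
  assumes p: "sublinear p" and t: "0 < t"
  shows "- p (- u) \<le> (p (x + t *\<^sub>R u) - p x) / t"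
proof -
  have "p x \<le> p (x + t *\<^sub>R u) + p (t *\<^sub>R (- u))"
    using sublinear_add[OF p, of "x + t *\<^sub>R u" "t *\<^sub>R (- u)"] by simp
  also have "p (t *\<^sub>R (- u)) = t * p (- u)"
    using t by (intro sublinear_scaleR[OF p]) simp
  finally show ?thesis
    using t by (simp add: pos_le_divide_eq algebra_simps)
qed

lemma sublinear_gateaux_exists:
  assumes p: "sublinear p"
  shows "\<exists>D. has_gateaux_derivative p u x D"
proof -
  define q where "q t = (p (x + t *\<^sub>R u) - p x) / t" for t
  have bdd: "bdd_below (q ` {0<..})"
    unfolding q_def using difference_quotient_lower_bound[OF p] by (intro bdd_belowI2) auto
  have "(q \<longlongrightarrow> Inf (q ` {0<..})) (at_right 0)"
  proof (rule order_tendstoI)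
    fix a assume a: "a < Inf (q ` {0<..})"
    have "a < q t" if "0 < t" for t
      using a cInf_lower[OF _ bdd, of "q t"] that by fastforce
    then show "eventually (\<lambda>t. a < q t) (at_right 0)"
      using eventually_at_right_less[of "0::real"] by (rule eventually_mono[rotated])
  next
    fix a assume "Inf (q ` {0<..}) < a"
    then obtain t where t: "0 < t" "q t < a"
      using cInf_less_iff[OF _ bdd, of a] by auto
    have "q s < a" if "0 < s" "s < t" for s
      using difference_quotient_mono[OF p, of s t x u] that t unfolding q_def by simp
    then show "eventually (\<lambda>s. q s < a) (at_right 0)"
      using t unfolding eventually_at_right_field by blast
  qed
  then show ?thesis
    unfolding has_gateaux_derivative_def q_def by blast
qed

lemma sublinear_has_gateaux:
  assumes "sublinear p"
  shows "has_gateaux_derivative p u x (gateaux_derivative p u x)"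
  using sublinear_gateaux_exists[OF assms] gateaux_derivativeI by metis

lemma gateaux_le_difference:
  assumes p: "sublinear p"
  shows "gateaux_derivative p u x \<le> p (x + u) - p x"
proof (rule tendsto_upperbound)
  show "((\<lambda>t. (p (x + t *\<^sub>R u) - p x) / t) \<longlongrightarrow> gateaux_derivative p u x) (at_right 0)"
    using sublinear_has_gateaux[OF p] unfolding has_gateaux_derivative_def .
  have "eventually (\<lambda>t::real. t \<in> {0<..<1}) (at_right 0)"
    by (rule eventually_at_right_real) simp
  then show "eventually (\<lambda>t. (p (x + t *\<^sub>R u) - p x) / t \<le> p (x + u) - p x) (at_right 0)"
  proof eventually_elim
    case (elim t)
    then show ?case using difference_quotient_mono[OF p, of t 1 x u] by simp
  qed
qed simp

lemma gateaux_le: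
  assumes "sublinear p"
  shows "gateaux_derivative p u x \<le> p u"
  using gateaux_le_difference[OF assms, of u x] sublinear_add[OF assms, of x u] by simp

lemma gateaux_add_le:
  assumes p: "sublinear p" and eq: "p (x + y) = p x + p y"
  shows "gateaux_derivative p (u + v) (x + y)
           \<le> gateaux_derivative p u x + gateaux_derivative p v y"
proof (rule tendsto_le[OF trivial_limit_at_right_real])
  note lim = sublinear_has_gateaux[OF p, unfolded has_gateaux_derivative_def]
  show "((\<lambda>t. (p (x + t *\<^sub>R u) - p x) / t + (p (y + t *\<^sub>R v) - p y) / t)
          \<longlongrightarrow> gateaux_derivative p u x + gateaux_derivative p v y) (at_right 0)"
    by (intro tendsto_add lim)
  show "((\<lambda>t. (p (x + y + t *\<^sub>R (u + v)) - p (x + y)) / t)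
          \<longlongrightarrow> gateaux_derivative p (u + v) (x + y)) (at_right 0)"
    by (rule lim)
  show "eventually (\<lambda>t. (p (x + y + t *\<^sub>R (u + v)) - p (x + y)) / t
          \<le> (p (x + t *\<^sub>R u) - p x) / t + (p (y + t *\<^sub>R v) - p y) / t) (at_right 0)"
    using eventually_at_right_less[of "0::real"]
  proof eventually_elim
    case (elim t)
    have "p (x + y + t *\<^sub>R (u + v)) \<le> p (x + t *\<^sub>R u) + p (y + t *\<^sub>R v)"
      using sublinear_add[OF p, of "x + t *\<^sub>R u" "y + t *\<^sub>R v"] by (simp add: algebra_simps)
    then show ?case
      using elim by (simp add: eq divide_right_mono flip: add_divide_distrib)
  qed
qed

lemma gateaux_scaleR_both:
  assumes p: "sublinear p" and k: "\<And>z. p (c *\<^sub>R z) = k * p z"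
  shows "gateaux_derivative p (c *\<^sub>R u) (c *\<^sub>R x) = k * gateaux_derivative p u x"
proof (rule gateaux_derivativeI)
  have "((\<lambda>t. k * ((p (x + t *\<^sub>R u) - p x) / t)) \<longlongrightarrow> k * gateaux_derivative p u x) (at_right 0)"
    using sublinear_has_gateaux[OF p] unfolding has_gateaux_derivative_def
    by (rule tendsto_mult_left)
  moreover have "p (c *\<^sub>R x + t *\<^sub>R c *\<^sub>R u) = k * p (x + t *\<^sub>R u)" for t
    using k[of "x + t *\<^sub>R u"] by (simp add: algebra_simps)
  ultimately show "has_gateaux_derivative p (c *\<^sub>R u) (c *\<^sub>R x) (k * gateaux_derivative p u x)"
    unfolding has_gateaux_derivative_def by (simp add: k right_diff_distrib)
qed

text \<open>Substituting \<open>c t\<close> for the step size \<open>t\<close>.\<close>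

lemma gateaux_scaleR_direction:
  assumes p: "sublinear p" and c: "0 \<le> c"
  shows "gateaux_derivative p (c *\<^sub>R u) x = c * gateaux_derivative p u x"
proof (cases "c = 0")
  case True
  then show ?thesis
    by (auto intro!: gateaux_derivativeI simp: has_gateaux_derivative_def)
next
  case False
  with c have c: "0 < c" by simp
  show ?thesis
  proof (rule gateaux_derivativeI)
    have "filterlim (\<lambda>t. c * t) (at_right 0) (at_right 0)"
      using c by (intro filterlim_times_pos[OF filterlim_ident]) auto
    from filterlim_compose[OF sublinear_has_gateaux[OF p, unfolded has_gateaux_derivative_def] this]
    have "((\<lambda>t. c * ((p (x + (c * t) *\<^sub>R u) - p x) / (c * t)))
            \<longlongrightarrow> c * gateaux_derivative p u x) (at_right 0)"
      by (rule tendsto_mult_left)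
    then show "has_gateaux_derivative p (c *\<^sub>R u) x (c * gateaux_derivative p u x)"
      unfolding has_gateaux_derivative_def using c by (simp add: mult.commute)
  qed
qed

text \<open>Subadditivity in the direction is joint subadditivity at the base points \<open>x, x\<close>, where
  \<open>p (x + x) = p x + p x\<close>, followed by rescaling the base point \<open>2 x\<close> to \<open>x\<close>.\<close>

lemma sublinear_gateaux:
  assumes p: "sublinear p"
  shows "sublinear (\<lambda>u. gateaux_derivative p u x)"
  unfolding sublinear_def
proof (intro conjI allI impI)
  show "gateaux_derivative p (c *\<^sub>R u) x = c * gateaux_derivative p u x" if "0 \<le> c" for c u
    using gateaux_scaleR_direction[OF p that] .
  have double: "p (2 *\<^sub>R z) = 2 * p z" for z
    by (simp add: sublinear_scaleR[OF p])
  fix u v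
  have "2 * gateaux_derivative p (u + v) x = gateaux_derivative p (2 *\<^sub>R (u + v)) (2 *\<^sub>R x)"
    by (rule gateaux_scaleR_both[OF p double, symmetric])
  also have "\<dots> = 2 * gateaux_derivative p (u + v) (x + x)"
    by (simp only: gateaux_scaleR_direction[OF p zero_le_numeral] scaleR_2[of x])
  finally have "gateaux_derivative p (u + v) x = gateaux_derivative p (u + v) (x + x)"
    by simp
  also have "\<dots> \<le> gateaux_derivative p u x + gateaux_derivative p v x"
    using double[of x] by (intro gateaux_add_le[OF p]) (simp add: scaleR_2)
  finally show "gateaux_derivative p (u + v) x
      \<le> gateaux_derivative p u x + gateaux_derivative p v x" .
qed

text \<open>For small \<open>t\<close> the point \<open>x + t s x\<close> is a nonnegative multiple of \<open>x\<close>, whatever the sign of \<open>s\<close>.\<close>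

lemma gateaux_radial:
  assumes p: "sublinear p"
  shows "gateaux_derivative p (s *\<^sub>R x) x = s * p x"
proof (rule gateaux_derivativeI)
  have "eventually (\<lambda>t::real. t \<in> {0<..<1 / (1 + \<bar>s\<bar>)}) (at_right 0)"
    by (rule eventually_at_right_real) simp
  then have "eventually (\<lambda>t. (p (x + t *\<^sub>R s *\<^sub>R x) - p x) / t = s * p x) (at_right 0)"
  proof eventually_elim
    case (elim t)
    then have "0 < t" "t * (1 + \<bar>s\<bar>) < 1"
      by (auto simp: pos_less_divide_eq)
    moreover have "- (t * \<bar>s\<bar>) \<le> t * s"
      using \<open>0 < t\<close> abs_ge_minus_self[of "t * s"] by (simp add: abs_mult)
    ultimately have "0 \<le> 1 + t * s" by (simp add: algebra_simps)
    then have "p ((1 + t * s) *\<^sub>R x) = (1 + t * s) * p x"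
      by (rule sublinear_scaleR[OF p])
    then show ?case using \<open>0 < t\<close> by (simp add: algebra_simps)
  qed
  then show "has_gateaux_derivative p (s *\<^sub>R x) x (s * p x)"
    unfolding has_gateaux_derivative_def by (rule tendsto_eventually)
qed

lemma gateaux_add_radial:
  assumes p: "sublinear p"
  shows "gateaux_derivative p (u + s *\<^sub>R x) x = gateaux_derivative p u x + s * p x"
proof -
  note add = sublinear_add[OF sublinear_gateaux[OF p, of x]]
  have "gateaux_derivative p (u + s *\<^sub>R x) x \<le> gateaux_derivative p u x + s * p x"
    using add[of u "s *\<^sub>R x"] by (simp add: gateaux_radial[OF p])
  moreover have "gateaux_derivative p u x \<le> gateaux_derivative p (u + s *\<^sub>R x) x - s * p x"
    using add[of "u + s *\<^sub>R x" "(- s) *\<^sub>R x"] gateaux_radial[OF p, of "- s" x] by simp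
  ultimately show ?thesis by simp
qed

lemma gateaux_at_zero:
  assumes p: "sublinear p"
  shows "gateaux_derivative p u 0 = p u"
proof (rule gateaux_derivativeI)
  have "eventually (\<lambda>t. (p (0 + t *\<^sub>R u) - p 0) / t = p u) (at_right 0)"
    using eventually_at_right_less[of "0::real"]
    by eventually_elim (simp add: sublinear_scaleR[OF p] sublinear_zero[OF p])
  then show "has_gateaux_derivative p u 0 (p u)"
    unfolding has_gateaux_derivative_def by (rule tendsto_eventually)
qed

section \<open>Linear minorants and subgradients\<close>

text \<open>Passing to a sublinear minorant never destroys oddness: if \<open>q \<le> p\<close> and \<open>p\<close> is odd at \<open>b\<close>, then
  \<open>q (-b) \<le> - p b \<le> - q b\<close>. Hence one differentiation per vector suffices.\<close>

lemma sublinear_minorant_odd_on: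
  assumes "finite B" and "sublinear p"
  shows "\<exists>q. sublinear q \<and> (\<forall>v. q v \<le> p v) \<and> (\<forall>b\<in>B. q (- b) = - q b)"
  using assms(1)
proof (induction B rule: finite_induct)
  case empty
  then show ?case using assms(2) by auto
next
  case (insert x B)
  then obtain q where q: "sublinear q" and le: "\<And>v. q v \<le> p v"
    and odd: "\<And>b. b \<in> B \<Longrightarrow> q (- b) = - q b" by blast
  define r where "r v = gateaux_derivative q v x" for v
  have r: "sublinear r"
    unfolding r_def by (rule sublinear_gateaux[OF q])
  have rq: "r v \<le> q v" for v
    unfolding r_def by (rule gateaux_le[OF q])
  have "r (- b) = - r b" if "b \<in> B" for b
    using rq[of b] rq[of "- b"] odd[OF that] sublinear_minus[OF r, of b] by simp
  moreover have "r (- x) = - r x"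
    using gateaux_radial[OF q, of 1 x] gateaux_radial[OF q, of "- 1" x] unfolding r_def by simp
  ultimately show ?case
    using r rq le order_trans by blast
qed

lemma linear_if_odd_on_Basis:
  fixes q :: "'a::euclidean_space \<Rightarrow> real"
  assumes q: "sublinear q" and odd: "\<And>b. b \<in> Basis \<Longrightarrow> q (- b) = - q b"
  shows "linear q"
proof -
  have "subspace {v. q (- v) = - q v}"
  proof (rule subspaceI)
    show "0 \<in> {v. q (- v) = - q v}" by (simp add: sublinear_zero[OF q])
    show "u + v \<in> {v. q (- v) = - q v}"
      if "u \<in> {v. q (- v) = - q v}" "v \<in> {v. q (- v) = - q v}" for u v
      using that sublinear_add[OF q, of u v] sublinear_add[OF q, of "- u" "- v"]
        sublinear_minus[OF q, of "u + v"] by simp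
    show "c *\<^sub>R v \<in> {v. q (- v) = - q v}" if "v \<in> {v. q (- v) = - q v}" for c v
      using that sublinear_scaleR[OF q, of c v] sublinear_scaleR[OF q, of c "- v"]
        sublinear_scaleR[OF q, of "- c" v] sublinear_scaleR[OF q, of "- c" "- v"]
      by (cases "0 \<le> c") auto
  qed
  then have "span Basis \<subseteq> {v. q (- v) = - q v}"
    using odd by (intro span_minimal) auto
  then have odd: "q (- v) = - q v" for v
    by auto
  show ?thesis
  proof (rule linearI)
    show "q (u + v) = q u + q v" for u v
      using sublinear_add[OF q, of u v] sublinear_add[OF q, of "u + v" "- v"] odd[of v] by simp
    show "q (c *\<^sub>R v) = c *\<^sub>R q v" for c v
      using sublinear_scaleR[OF q, of c v] sublinear_scaleR[OF q, of "- c" v] odd[of "c *\<^sub>R v"]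
      by (cases "0 \<le> c") auto
  qed
qed

text \<open>The Hahn--Banach theorem in finite dimension. The first differentiation is at \<open>u\<close> itself: the
  values of the resulting function at \<open>u\<close> and \<open>-u\<close> are \<open>p u\<close> and \<open>- p u\<close>, so they leave no
  freedom to any minorant that is linear.\<close>

lemma linear_minorant_touching:
  fixes p :: "'a::euclidean_space \<Rightarrow> real"
  assumes p: "sublinear p"
  shows "\<exists>y. (\<forall>v. y \<bullet> v \<le> p v) \<and> y \<bullet> u = p u"
proof -
  obtain q where q: "sublinear q" and le: "\<And>v. q v \<le> gateaux_derivative p v u"
    and odd: "\<And>b. b \<in> Basis \<Longrightarrow> q (- b) = - q b"
    using sublinear_minorant_odd_on[OF finite_Basis sublinear_gateaux[OF p]] by metis
  have lin: "linear q"
    by (rule linear_if_odd_on_Basis[OF q odd])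
  have inner: "adjoint q 1 \<bullet> v = q v" for v
    using adjoint_works[OF lin, of v 1] by (simp add: inner_commute)
  have "q v \<le> p v" for v
    using le[of v] gateaux_le[OF p, of v u] by simp
  moreover have "q u = p u"
    using le[of u] le[of "- u"] gateaux_radial[OF p, of 1 u] gateaux_radial[OF p, of "- 1" u]
      linear_neg[OF lin, of u] by simp
  ultimately show ?thesis using inner by metis
qed

lemma subgradient_inner_le_gateaux:
  assumes p: "sublinear p" and y: "y \<in> subdifferential p x"
  shows "y \<bullet> u \<le> gateaux_derivative p u x"
proof (rule tendsto_lowerbound)
  show "((\<lambda>t. (p (x + t *\<^sub>R u) - p x) / t) \<longlongrightarrow> gateaux_derivative p u x) (at_right 0)"
    using sublinear_has_gateaux[OF p] unfolding has_gateaux_derivative_def .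
  show "eventually (\<lambda>t. y \<bullet> u \<le> (p (x + t *\<^sub>R u) - p x) / t) (at_right 0)"
    using eventually_at_right_less[of "0::real"]
  proof eventually_elim
    case (elim t)
    have "p x + y \<bullet> (x + t *\<^sub>R u - x) \<le> p (x + t *\<^sub>R u)"
      using y unfolding subdifferential_def by blast
    then show ?case using elim by (simp add: pos_le_divide_eq algebra_simps)
  qed
qed simp

text \<open>A linear minorant \<open>y\<close> of the directional derivative at \<open>x\<close> is a subgradient at \<open>x\<close>, because
  \<open>y \<bullet> (z - x) \<le> D\<^bsub>z - x\<^esub> p(x) \<le> p z - p x\<close>.\<close>

lemma gateaux_eq_max_subgradient:
  fixes p :: "'a::euclidean_space \<Rightarrow> real"
  assumes p: "sublinear p"
  shows "\<exists>y. is_arg_max (\<lambda>y. y \<bullet> u) (\<lambda>y. y \<in> subdifferential p x) y \<and>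
             y \<bullet> u = gateaux_derivative p u x"
proof -
  obtain y where le: "\<And>v. y \<bullet> v \<le> gateaux_derivative p v x"
    and eq: "y \<bullet> u = gateaux_derivative p u x"
    using linear_minorant_touching[OF sublinear_gateaux[OF p, of x], of u] by blast
  have "p x + y \<bullet> (z - x) \<le> p z" for z
    using le[of "z - x"] gateaux_le_difference[OF p, of "z - x" x] by simp
  then have "y \<in> subdifferential p x"
    unfolding subdifferential_def by simp
  then show ?thesis
    using eq subgradient_inner_le_gateaux[OF p] unfolding is_arg_max_def
    by (metis not_less)
qed

section \<open>The dual continuation of a norm\<close>

lemma vector_norm_sublinear: "vector_norm N \<Longrightarrow> sublinear N"
  by (simp add: vector_norm_def sublinear_def scalar_mult_eq_scaleR)

lemma dual_continuation_Dual:
  "dual_continuation \<phi> x =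
     Dual (\<phi> (std_vec x)) (gateaux_derivative \<phi> (inf_vec x) (std_vec x))"
  by (simp add: dual_continuation_def Dual_eq)

lemma std_vec_add: "std_vec (x + y) = std_vec x + std_vec y"
  by (simp add: std_vec_def vec_eq_iff plus_dual_def)

lemma inf_vec_add: "inf_vec (x + y) = inf_vec x + inf_vec y"
  by (simp add: inf_vec_def vec_eq_iff plus_dual_def)

lemma std_vec_scale: "std_vec (c *s x) = std_part c *\<^sub>R std_vec x"
  by (simp add: std_vec_def vec_eq_iff times_dual_def)

lemma inf_vec_scale:
  "inf_vec (c *s x) = std_part c *\<^sub>R inf_vec x + inf_part c *\<^sub>R std_vec x"
  by (simp add: inf_vec_def std_vec_def vec_eq_iff times_dual_def)

lemma dual_vec_eq_0_iff: "x = 0 \<longleftrightarrow> std_vec x = 0 \<and> inf_vec x = 0"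
  by (auto simp: std_vec_def inf_vec_def vec_eq_iff zero_dual_def dual.expand)

lemma dual_continuation_scale:
  assumes N: "vector_norm N"
  shows "dual_continuation N (c *s x) = \<bar>c\<bar> * dual_continuation N x"
proof -
  note sub = vector_norm_sublinear[OF N]
  have hom: "N (a *\<^sub>R z) = \<bar>a\<bar> * N z" for a z
    using N by (simp add: vector_norm_def scalar_mult_eq_scaleR)
  define a b where "a = std_part c" and "b = inf_part c"
  define xs xi where "xs = std_vec x" and "xi = inf_vec x"
  show ?thesis
  proof (cases "a = 0")
    case True
    then show ?thesis
      by (simp add: dual_continuation_Dual std_vec_scale inf_vec_scale abs_dual_def times_dual_def
          gateaux_at_zero[OF sub] sublinear_zero[OF sub] hom flip: a_def)
  next
    case False
    \<comment> \<open>Factoring out \<open>a\<close> leaves the radial perturbation \<open>(b / a) xs\<close> of the direction \<open>xi\<close>.\<close>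
    have "a *\<^sub>R xi + b *\<^sub>R xs = a *\<^sub>R (xi + (b / a) *\<^sub>R xs)"
      using False by (simp add: algebra_simps)
    then have "gateaux_derivative N (a *\<^sub>R xi + b *\<^sub>R xs) (a *\<^sub>R xs)
        = \<bar>a\<bar> * (gateaux_derivative N xi xs + b / a * N xs)"
      by (simp add: gateaux_scaleR_both[OF sub hom] gateaux_add_radial[OF sub])
    also have "\<dots> = \<bar>a\<bar> * gateaux_derivative N xi xs + sgn a * b * N xs"
      using False by (simp add: algebra_simps sgn_if abs_if)
    finally show ?thesis
      using False
      by (simp add: dual_continuation_Dual std_vec_scale inf_vec_scale abs_dual_def times_dual_def
          hom flip: a_def b_def xs_def xi_def)
  qed
qed

lemma dual_continuation_triangle:
  assumes N: "sublinear N"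
  shows "dual_continuation N (x + y) \<le> dual_continuation N x + dual_continuation N y"
proof (cases "N (std_vec x + std_vec y) = N (std_vec x) + N (std_vec y)")
  case True
  then show ?thesis
    using gateaux_add_le[OF N True, of "inf_vec x" "inf_vec y"]
    by (auto simp: dual_continuation_Dual std_vec_add inf_vec_add plus_dual_def
        less_eq_dual_def less_dual_def)
next
  case False
  then show ?thesis
    using sublinear_add[OF N, of "std_vec x" "std_vec y"]
    by (auto simp: dual_continuation_Dual std_vec_add inf_vec_add plus_dual_def
        less_eq_dual_def less_dual_def)
qed

lemma dual_continuation_definite:
  assumes N: "vector_norm N"
  shows "0 \<le> dual_continuation N x \<and> (dual_continuation N x = 0 \<longleftrightarrow> x = 0)"
proof -
  note sub = vector_norm_sublinear[OF N]
  have nonneg: "0 \<le> N z" and zero: "N z = 0 \<longleftrightarrow> z = 0" for z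
    using N by (auto simp: vector_norm_def)
  show ?thesis
  proof (cases "std_vec x = 0")
    case True
    then show ?thesis
      using nonneg[of "inf_vec x"] zero[of "inf_vec x"] zero[of 0]
      by (auto simp: dual_continuation_Dual gateaux_at_zero[OF sub] dual_vec_eq_0_iff
          zero_dual_def less_eq_dual_def less_dual_def)
  next
    case False
    then have "0 < N (std_vec x)"
      using nonneg zero by (metis less_eq_real_def)
    then show ?thesis
      using False
      by (auto simp: dual_continuation_Dual dual_vec_eq_0_iff
          zero_dual_def less_eq_dual_def less_dual_def)
  qed
qed

theorem theorem4p2:
  fixes N :: "real ^ 'n \<Rightarrow> real"
  assumes "vector_norm N"
  shows "(\<forall>a b. \<exists>D. has_gateaux_derivative N b a D) \<and>
    (\<forall>x :: dual ^ 'n.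
       (std_vec x \<noteq> 0 \<longrightarrow>
          (\<exists>y. is_arg_max (\<lambda>y. y \<bullet> inf_vec x) (\<lambda>y. y \<in> subdifferential N (std_vec x)) y \<and>
               dual_continuation N x = of_real (N (std_vec x)) + of_real (y \<bullet> inf_vec x) * eps)) \<and>
       (std_vec x = 0 \<longrightarrow> dual_continuation N x = of_real (N (inf_vec x)) * eps)) \<and>
    dual_vector_norm (dual_continuation N)"
proof -
  note sub = vector_norm_sublinear[OF assms]
  show ?thesis
  proof (intro conjI allI impI)
    show "\<exists>D. has_gateaux_derivative N b a D" for a b
      by (rule sublinear_gateaux_exists[OF sub])
    show "\<exists>y. is_arg_max (\<lambda>y. y \<bullet> inf_vec x) (\<lambda>y. y \<in> subdifferential N (std_vec x)) y \<and>
              dual_continuation N x = of_real (N (std_vec x)) + of_real (y \<bullet> inf_vec x) * eps"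
      for x :: "dual ^ 'n"
      using gateaux_eq_max_subgradient[OF sub, of "inf_vec x" "std_vec x"]
      unfolding dual_continuation_def by metis
    show "dual_continuation N x = of_real (N (inf_vec x)) * eps" if "std_vec x = 0"
      for x :: "dual ^ 'n"
      using that by (simp add: dual_continuation_def gateaux_at_zero[OF sub] sublinear_zero[OF sub])
    show "dual_vector_norm (dual_continuation N)"
      unfolding dual_vector_norm_def
      using dual_continuation_definite[OF assms] dual_continuation_scale[OF assms]
        dual_continuation_triangle[OF sub] by blast
  qed
qed

end
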